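(* Let $q=2^m$, where $m$ is a positive integer. Then $$f_3(X)=X^{1+q}+X^{1+q^2}+X^{2q+2}$$ is a permutation polynomial over $\mathbb{F}_{q^3}$ if and only if $m\not\equiv 1\pmod 3$.
   Context: A polynomial $f\in\mathbb{F}_{Q}[X]$ is a permutation polynomial over $\mathbb{F}_Q$ if $c\mapsto f(c)$ is a bijection of $\mathbb{F}_Q$. *)

theory Defs
  imports
    "HOL-Computational_Algebra.Polynomial"
    "HOL-Library.Cardinality"
    "HOL-Number_Theory.Cong"
begin

definition permutation_polynomial :: "'a::{finite,field} poly \<Rightarrow> bool"
  where "permutation_polynomial f \<longleftrightarrow> bij (\<lambda>c. poly f c)"

definition f3 :: "nat \<Rightarrow> 'a::comm_semiring_1 poly"
  where "f3 q = monom 1 (1 + q) + monom 1 (1 + q^2) + monom 1 (2 * q + 2)"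

end

theory Submission
  imports Defs
begin

text \<open>
  As \<open>f\<^sub>3(x) = L(x\<^bsup>q+1\<^esup>)\<close> with \<open>L(a) = a\<^sup>2 + a + a\<^bsup>q\<^sup>2\<^esup>\<close> and \<open>q + 1\<close> is coprime to \<open>q\<^sup>3 - 1\<close>, the question
  is whether the additive map \<open>L\<close> has trivial kernel. Let \<open>a\<close> be in the kernel and let \<open>a, b, c\<close>
  be its conjugates under \<open>x \<mapsto> x\<^sup>q\<close>, so that \<open>c = a\<^sup>2 + a\<close>, \<open>a = b\<^sup>2 + b\<close> and \<open>b = c\<^sup>2 + c\<close>. Adding these
  shows \<open>a + b + c = 0\<close>, hence \<open>a\<^sup>q = b = a\<^sup>2\<close>, and then \<open>a\<^sup>8 = a\<close>, \<open>a\<^sup>4 = a\<^sup>2 + a\<close>. Thus \<open>a\<close> lies in the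
  field with 8 elements, where \<open>a\<^sup>q\<close> depends only on \<open>m\<close> modulo 3; a nonzero \<open>a\<close> is a root of
  \<open>X\<^sup>3 + X + 1\<close>, and \<open>a\<^sup>q = a\<^sup>2\<close> holds for it exactly if \<open>m \<equiv> 1\<close> modulo 3.
\<close>

section \<open>Finite fields of characteristic two\<close>

text \<open>Multiplication by \<open>x\<close> permutes the nonzero elements, so their nonzero
  product absorbs the factor \<open>x ^ (CARD('a) - 1)\<close>.\<close>

lemma power_card_minus_one_eq_one:
  fixes x :: "'a::{finite,field}"
  assumes "x \<noteq> 0"
  shows "x ^ (CARD('a) - 1) = 1"
proof -
  have "bij_betw ((*) x) (-{0}) (-{0})"
    using assms by (intro bij_betw_byWitness[where f' = "\<lambda>y. y / x"]) auto
  then have "(\<Prod>y\<in>-{0}. x * y) = \<Prod>(-{0})"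
    by (rule prod.reindex_bij_betw)
  moreover have "(\<Prod>y\<in>-{0}. x * y) = x ^ (CARD('a) - 1) * \<Prod>(-{0})"
    by (simp add: prod.distrib Compl_eq_Diff_UNIV)
  moreover have "\<Prod>(-{0::'a}) \<noteq> 0"
    by simp
  ultimately show ?thesis
    by simp
qed

lemma power_card_eq_self:
  fixes x :: "'a::{finite,field}"
  shows "x ^ CARD('a) = x"
proof -
  have "x ^ CARD('a) = x * x ^ (CARD('a) - 1)"
    by (simp flip: power_Suc)
  then show ?thesis
    using power_card_minus_one_eq_one[of x] by (cases "x = 0") simp_all
qed

text \<open>Translation by 1 permutes the field; comparing the sums over all elements gives
  \<open>of_nat (CARD('a)) = 0\<close>, so the prime characteristic divides
  \<open>p ^ n\<close>.\<close>

lemma char_eq_prime_if_card_eq_power: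
  assumes "CARD('a::{finite,field}) = p ^ n" and "prime p"
  shows "CHAR('a) = p"
proof -
  have "prime CHAR('a)"
    by (intro prime_CHAR_semidom finite_imp_CHAR_pos finite)
  moreover have "CHAR('a) dvd p ^ n"
  proof -
    have "(\<Sum>x\<in>UNIV. x + 1) = (\<Sum>x\<in>UNIV. x::'a)"
      by (rule sum.reindex_bij_witness[of _ "\<lambda>x. x - 1" "\<lambda>x. x + 1"]) auto
    then have "of_nat (CARD('a)) = (0::'a)"
      by (simp add: sum.distrib)
    then show ?thesis
      using assms(1) by (metis of_nat_eq_0_iff_char_dvd)
  qed
  ultimately show ?thesis
    using assms(2) by (metis prime_dvd_power primes_dvd_imp_eq)
qed

lemma add_self_char_two:
  fixes x :: "'a::comm_ring_1"
  assumes "CHAR('a) = 2"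
  shows "x + x = 0"
proof -
  have "(2::'a) = 0"
    using of_nat_CHAR[where 'a = 'a] assms by simp
  then show ?thesis
    by (metis mult_2 mult_zero_left)
qed

lemma eq_iff_add_eq_0_char_two:
  fixes x y :: "'a::comm_ring_1"
  assumes "CHAR('a) = 2"
  shows "x = y \<longleftrightarrow> x + y = 0"
  using add_self_char_two[OF assms] by (metis add_right_imp_eq)

text \<open>The hypothesis says that squaring three times fixes \<open>x\<close>.\<close>

lemma power_2_power_mod_3:
  fixes x :: "'a::monoid_mult"
  assumes "x ^ 8 = x"
  shows "x ^ 2 ^ n = x ^ 2 ^ (n mod 3)"
proof -
  have "x ^ 2 ^ (3 * k) = x" for k
    by (induction k) (simp_all add: assms power_add power_mult)
  then have "(x ^ 2 ^ (3 * (n div 3))) ^ 2 ^ (n mod 3) = x ^ 2 ^ (n mod 3)"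
    by simp
  then show ?thesis
    by (simp only: mult_div_mod_eq flip: power_mult power_add)
qed

text \<open>Otherwise all \<open>7 * k\<close> nonzero elements would be roots of X^k - 1, because
  the 7th power of \<open>x ^ k\<close> is 1.\<close>

lemma exists_primitive_root_of_unity_7:
  assumes "7 dvd CARD('a::{finite,field}) - 1"
  shows "\<exists>x::'a. x ^ 7 = 1 \<and> x \<noteq> 1"
proof (rule ccontr)
  assume no: "\<not> ?thesis"
  obtain k where k: "CARD('a) - 1 = 7 * k"
    using assms by blast
  have card: "CARD('a) > 1"
    by (metis UNIV_I card_1_singletonE finite finite_UNIV_card_ge_0 less_one linorder_neqE_nat
        singletonD zero_neq_one less_numeral_extra(3))
  have k0: "k > 0"
    using k card by (cases k) auto
  define p :: "'a poly" where "p = monom 1 k - 1"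
  have deg: "degree p = k"
    unfolding p_def using k0 by (subst diff_conv_add_uminus, subst degree_add_eq_left) (auto simp: degree_monom_eq)
  have "x ^ k = 1" if "x \<noteq> 0" for x :: 'a
  proof -
    have "(x ^ k) ^ 7 = 1"
      using power_card_minus_one_eq_one[OF that] k by (simp add: mult.commute flip: power_mult)
    then show ?thesis
      using no by blast
  qed
  then have "-{0} \<subseteq> {x. poly p x = 0}"
    by (auto simp: p_def poly_monom)
  then have "card (-{0::'a}) \<le> card {x. poly p x = 0}"
    by (intro card_mono) auto
  also have "\<dots> \<le> k"
    using card_poly_roots_bound[of p] deg k0 by fastforce
  finally show False
    using k k0 by (simp add: Compl_eq_Diff_UNIV)
qed

text \<open>The factorization of X^7 - 1 into irreducibles over the field with 2 elements, with the
  error term that vanishes in characteristic 2.\<close>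

lemma power_7_minus_one_factors:
  fixes x :: "'a::comm_ring_1"
  shows "(x - 1) * ((x ^ 3 + x + 1) * (x ^ 3 + x ^ 2 + 1)) = x ^ 7 - 1 + 2 * (x ^ 4 - x ^ 3)"
  by (simp add: algebra_simps eval_nat_numeral)

lemma exists_root_cubic_char_two:
  assumes "CHAR('a::{finite,field}) = 2" and "7 dvd CARD('a) - 1"
  shows "\<exists>a::'a. a ^ 3 + a + 1 = 0"
proof -
  have two: "(2::'a) = 0"
    using of_nat_CHAR[where 'a = 'a] assms(1) by simp
  obtain x :: 'a where x: "x ^ 7 = 1" "x \<noteq> 1"
    using exists_primitive_root_of_unity_7 assms(2) by blast
  have "(x - 1) * ((x ^ 3 + x + 1) * (x ^ 3 + x ^ 2 + 1)) = 0"
    using x(1) two power_7_minus_one_factors[of x] by simp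
  then consider "x ^ 3 + x + 1 = 0" | "x ^ 3 + x ^ 2 + 1 = 0"
    using x(2) by auto
  then show ?thesis
  proof cases
    case 2
    \<comment> \<open>the two cubics are reciprocal to each other, and \<open>x\<^sup>6\<close> is the inverse of \<open>x\<close>\<close>
    have "(x ^ 6) ^ 3 = (x ^ 7) ^ 2 * x ^ 4"
      by (simp flip: power_mult power_add)
    moreover have "x ^ 4 + x ^ 6 + 1 = (x ^ 3 + x ^ 2 + 1) ^ 2 - 2 * (x ^ 5 + x ^ 3 + x ^ 2)"
      by algebra
    ultimately have "(x ^ 6) ^ 3 + x ^ 6 + 1 = 0"
      using 2 x(1) two by simp
    then show ?thesis ..
  qed blast
qed

section \<open>Reduction to the kernel of an additive map\<close>

text \<open>A quotient \<open>t\<close> of two nonzero elements with equal images satisfies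
  \<open>t ^ q = inverse t\<close>. Raising to the power \<open>q\<close> three times fixes
  \<open>t\<close> but also inverts it, so \<open>t * t = 1\<close>, which forces
  \<open>t = 1\<close> in characteristic 2.\<close>

lemma inj_power_Suc_q:
  fixes q :: nat
  assumes "CARD('a::{finite,field}) = q ^ 3" and "CHAR('a) = 2"
  shows "inj (\<lambda>x::'a. x ^ (q + 1))"
proof (rule injI)
  fix x y :: 'a
  assume eq: "x ^ (q + 1) = y ^ (q + 1)"
  show "x = y"
  proof (cases "y = 0")
    case True
    then have "x ^ (q + 1) = 0"
      using eq by simp
    then show ?thesis
      using True by (metis power_eq_0_iff)
  next
    case False
    define t where "t = x / y"
    have "t ^ (q + 1) = 1"
      using eq False by (simp add: t_def power_divide)
    then have t: "t * t ^ q = 1"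
      by simp
    then have tq: "t ^ q = inverse t"
      by (metis inverse_unique)
    have "t = t ^ (q * q * q)"
      using power_card_eq_self[of t] assms(1) by (simp add: power3_eq_cube)
    also have "\<dots> = inverse t"
      by (simp add: power_mult tq power_inverse)
    finally have "t * t = 1"
      using t tq by metis
    then have "(t + 1) * (t + 1) = 0"
      using add_self_char_two[OF assms(2)]
      by (metis (no_types, opaque_lifting) add.assoc add.commute add.right_neutral distrib_left distrib_right mult.right_neutral mult_1)
    then have "t = 1"
      using eq_iff_add_eq_0_char_two[OF assms(2)] by auto
    then show ?thesis
      using False by (simp add: t_def)
  qed
qed

definition f3_linearized :: "nat \<Rightarrow> 'a::comm_semiring_1 \<Rightarrow> 'a"
  where "f3_linearized q a = a ^ 2 + a + a ^ q ^ 2"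

text \<open>Only the term with exponent \<open>1 + q ^ 2\<close> needs the field size: (q + 1) q^2 =
  q^3 + q^2, and \<open>x ^ q ^ 3 = x\<close>.\<close>

lemma poly_f3:
  assumes "CARD('a::{finite,field}) = q ^ 3"
  shows "poly (f3 q) (x::'a) = f3_linearized q (x ^ (q + 1))"
proof -
  have "(x ^ (q + 1)) ^ q ^ 2 = x ^ q ^ 3 * x ^ q ^ 2"
    by (simp add: power_mult_distrib flip: power_mult power_add)
       (simp add: power2_eq_square power3_eq_cube algebra_simps)
  also have "x ^ q ^ 3 = x"
    using power_card_eq_self[of x] assms by simp
  finally have "(x ^ (q + 1)) ^ q ^ 2 = x ^ (1 + q ^ 2)"
    by simp
  moreover have "(x ^ (q + 1)) ^ 2 = x ^ (2 * q + 2)"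
    by (simp only: flip: power_mult) (simp add: algebra_simps)
  ultimately show ?thesis
    unfolding f3_def f3_linearized_def poly_add poly_monom
    by (simp only: mult_1 add.commute[of q 1] ac_simps)
qed

text \<open>All exponents in \<open>f3_linearized q\<close> are powers of 2, so the map is additive
  in characteristic 2.\<close>

lemma inj_f3_linearized_iff:
  assumes "CHAR('a::{finite,field}) = 2" and "q = 2 ^ m"
  shows "inj (f3_linearized q :: 'a \<Rightarrow> 'a) \<longleftrightarrow> (\<forall>a::'a. f3_linearized q a = 0 \<longrightarrow> a = 0)"
proof -
  have "(x + y) ^ q ^ 2 = x ^ q ^ 2 + y ^ q ^ 2" for x y :: 'a
    by (rule freshmans_dream'[where n = "m * 2"]) (simp_all add: assms power_mult)
  moreover have "(x + y) ^ 2 = x ^ 2 + y ^ 2" for x y :: 'a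
    by (rule freshmans_dream) (simp_all add: assms)
  ultimately have add: "f3_linearized q (x + y) = f3_linearized q x + f3_linearized q y" for x y :: 'a
    by (simp add: f3_linearized_def algebra_simps)
  have zero: "f3_linearized q (0::'a) = 0"
    by (simp add: f3_linearized_def assms(2))
  show ?thesis
    using add zero eq_iff_add_eq_0_char_two[OF assms(1)] unfolding inj_def by metis
qed

section \<open>The kernel of the additive map\<close>

lemma f3_linearized_eq_0D:
  fixes a :: "'a::{finite,field}"
  assumes card: "CARD('a) = q ^ 3" and char: "CHAR('a) = 2" and q: "q = 2 ^ m"
    and zero: "f3_linearized q a = 0"
  shows "a ^ q = a ^ 2" and "a ^ 4 = a ^ 2 + a"
proof -
  have add_q: "(x + y) ^ q = x ^ q + y ^ q" for x y :: 'a
    by (rule freshmans_dream'[where n = m]) (simp_all add: char q)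
  have two: "(2::'a) = 0"
    using of_nat_CHAR[where 'a = 'a] char by simp
  define b c where "b = a ^ q" and "c = b ^ q"
  have cq: "c ^ q = a"
    using power_card_eq_self[of a] card
    by (simp add: b_def c_def power3_eq_cube mult.assoc flip: power_mult)
  have "a ^ q ^ 2 = c"
    by (simp add: b_def c_def power2_eq_square power_mult)
  then have 1: "a ^ 2 + a + c = 0"
    using zero by (simp add: f3_linearized_def)
  have sq: "(x ^ 2) ^ q = (x ^ q) ^ 2" for x :: 'a
    by (simp add: mult.commute flip: power_mult)
  \<comment> \<open>Raising to the power \<open>q\<close> sends \<open>a\<close> to
    \<open>b\<close>, \<open>b\<close> to \<open>c\<close> and \<open>c\<close> to \<open>a\<close>,
    and so carries each relation to the next.\<close>
  have "(a ^ 2 + a + c) ^ q = 0"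
    using 1 q by (simp del: power_eq_0_iff) simp
  then have 2: "b ^ 2 + b + a = 0"
    by (simp only: add_q sq cq flip: b_def)
  have "(b ^ 2 + b + a) ^ q = 0"
    using 2 q by (simp del: power_eq_0_iff) simp
  then have 3: "c ^ 2 + c + b = 0"
    by (simp only: add_q sq flip: b_def c_def)
  have "(a + b + c) ^ 2 = (a ^ 2 + a + c) + (b ^ 2 + b + a) + (c ^ 2 + c + b)
      + 2 * (a * b + b * c + c * a - a - b - c)"
    by algebra
  then have "(a + b + c) ^ 2 = 0"
    using 1 2 3 two by simp
  then have "a + b + c = 0"
    by simp
  then have ba: "b = a ^ 2"
    using 1 by algebra
  then show "a ^ q = a ^ 2"
    by (simp add: b_def)
  \<comment> \<open>This is the second relation with \<open>b\<close> replaced by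
    \<open>a ^ 2\<close>.\<close>
  show "a ^ 4 = a ^ 2 + a"
    using 2 eq_iff_add_eq_0_char_two[OF char, of "a ^ 4"] unfolding ba
    by (simp add: add.assoc flip: power_mult)
qed

lemma f3_linearized_kernel_trivial_iff:
  assumes card: "CARD('a::{finite,field}) = q ^ 3" and char: "CHAR('a) = 2" and q: "q = 2 ^ m"
  shows "(\<forall>a::'a. f3_linearized q a = 0 \<longrightarrow> a = 0) \<longleftrightarrow> m mod 3 \<noteq> 1"
proof
  have two: "(2::'a) = 0"
    using of_nat_CHAR[where 'a = 'a] char by simp
  show "m mod 3 \<noteq> 1" if triv: "\<forall>a::'a. f3_linearized q a = 0 \<longrightarrow> a = 0"
  proof
    assume m: "m mod 3 = 1"
    have "q ^ 3 = 8 ^ m"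
      by (simp add: q power_mult[symmetric] mult.commute[of m]) (simp add: power_mult)
    moreover have "(7::nat) dvd 8 ^ m - 1"
      by (rule cong_to_1_nat) (use cong_pow[of 8 1 "7::nat" m] in \<open>simp add: cong_def\<close>)
    ultimately obtain a :: 'a where a: "a ^ 3 + a + 1 = 0"
      using exists_root_cubic_char_two[where 'a = 'a] char card by auto
    \<comment> \<open>A root of X^3 + X + 1 is a 7th root of unity by the factorization of X^7 -
      1.\<close>
    have "a ^ 8 = a"
      using a two power_7_minus_one_factors[of a] by (simp add: power_Suc[of a 7, simplified])
    moreover have "(2 * m) mod 3 = 2"
      using m by presburger
    moreover have "q ^ 2 = 2 ^ (2 * m)"
      by (simp add: q mult.commute flip: power_mult)
    ultimately have "a ^ q ^ 2 = a ^ 4"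
      using power_2_power_mod_3[of a "2 * m"] by simp
    then have "f3_linearized q a = 0"
    proof -
      have "a ^ 2 + a + a ^ 4 = a * (a ^ 3 + a + 1)"
        by algebra
      then show ?thesis
        using \<open>a ^ q ^ 2 = a ^ 4\<close> a by (simp add: f3_linearized_def)
    qed
    then have "a = 0"
      using triv by blast
    then show False
      using a by simp
  qed
  show "\<forall>a::'a. f3_linearized q a = 0 \<longrightarrow> a = 0" if m: "m mod 3 \<noteq> 1"
  proof (intro allI impI)
    fix a :: 'a
    assume "f3_linearized q a = 0"
    then have aq: "a ^ q = a ^ 2" and a4: "a ^ 4 = a ^ 2 + a"
      using f3_linearized_eq_0D[OF card char q] by blast+
    have "a ^ 8 = a"
    proof -
      have "a ^ 8 = (a ^ 4) ^ 2"
        by simp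
      also have "\<dots> = (a ^ 2 + a) ^ 2"
        by (simp only: a4)
      also have "\<dots> = a ^ 4 + a ^ 2 + 2 * a ^ 3"
        by algebra
      also have "\<dots> = a + 2 * (a ^ 2 + a ^ 3)"
        unfolding a4 by algebra
      finally show ?thesis
        using two by simp
    qed
    then have aq': "a ^ 2 = a ^ 2 ^ (m mod 3)"
      using power_2_power_mod_3[of a m] aq q by simp
    consider "m mod 3 = 0" | "m mod 3 = 2"
      using m by linarith
    then show "a = 0"
    \<comment> \<open>In the first case \<open>a ^ 2 = a\<close> gives \<open>a ^ 4 = a ^ 2\<close>;
      in the second \<open>a ^ 2 = a ^ 4\<close> holds directly. Comparing with
      \<open>a ^ 4 = a ^ 2 + a\<close> leaves \<open>a = 0\<close>.\<close>
    proof cases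
      case 1
      then have "a ^ 2 = a"
        using aq' by simp
      moreover have "(a ^ 2) ^ 2 = a ^ 2 + a"
        using a4 by (simp flip: power_mult)
      ultimately show ?thesis
        by (metis add_cancel_right_left)
    next
      case 2
      then show ?thesis
        using aq' a4 by simp
    qed
  qed
qed

theorem theorem3p3:
  fixes m q :: nat
  assumes "m > 0"
    and "q = 2 ^ m"
    and "CARD('a::{finite,field}) = q ^ 3"
  shows "permutation_polynomial (f3 q :: 'a poly) \<longleftrightarrow> \<not> [m = 1] (mod 3)"
proof -
  have char: "CHAR('a) = 2"
    by (rule char_eq_prime_if_card_eq_power[where n = "m * 3"])
       (simp_all add: assms power_mult)
  have inj_pow: "inj (\<lambda>x::'a. x ^ (q + 1))"
    using assms(3) char by (rule inj_power_Suc_q)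
  then have bij_pow: "bij (\<lambda>x::'a. x ^ (q + 1))"
    by (simp only: bij_def finite_UNIV_inj_surj[OF finite] simp_thms)
  have "poly (f3 q) = f3_linearized q \<circ> (\<lambda>x::'a. x ^ (q + 1))"
    using poly_f3[OF assms(3)] by auto
  then have "permutation_polynomial (f3 q :: 'a poly)
      \<longleftrightarrow> bij (f3_linearized q \<circ> (\<lambda>x::'a. x ^ (q + 1)))"
    unfolding permutation_polynomial_def by (rule arg_cong)
  also have "\<dots> \<longleftrightarrow> bij (f3_linearized q :: 'a \<Rightarrow> 'a)"
    using bij_pow by (metis bij_betw_comp_iff)
  also have "\<dots> \<longleftrightarrow> inj (f3_linearized q :: 'a \<Rightarrow> 'a)"
    using finite_UNIV_inj_surj[OF finite] by (auto simp only: bij_def)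
  also have "\<dots> \<longleftrightarrow> m mod 3 \<noteq> 1"
    using inj_f3_linearized_iff[OF char assms(2)]
      f3_linearized_kernel_trivial_iff[OF assms(3) char assms(2)] by simp
  finally show ?thesis
    by (simp add: cong_def)
qed

end
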